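(* Let $p>3$ be a prime. Let $(S_n)_{n\ge0}$ and $(T_n)_{n\ge0}$ be defined by $S_0=0$, $S_1=1$, $S_{n+1}=4S_n-S_{n-1}$ and $T_0=2$, $T_1=4$, $T_{n+1}=4T_n-T_{n-1}$ for $n\ge1$. Then $$\sum_{k=0}^{p-1}S_k\binom{2k}{k}\equiv2\left(\left(\frac p3\right)-\left(\frac{-1}p\right)\right)\pmod{p^2}$$ and $$\sum_{k=0}^{p-1}S_{k+1}\binom{2k}{k}\equiv\left(\frac p3\right)\pmod{p^2}.$$ Also, $$\sum_{k=0}^{(p-1)/2}\frac{S_k}{16^k}\binom{2k}{k}\equiv\frac{\left(\frac 6p\right)-\left(\frac 2p\right)}{2}\pmod{p^2}$$ and $$\sum_{k=0}^{(p-1)/2}\frac{T_k}{16^k}\binom{2k}{k}\equiv3\left(\frac 6p\right)-\left(\frac 2p\right)\pmod{p^2}.$$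
   Context: $\left(\frac{\cdot}{\cdot}\right)$ is the Jacobi symbol. A congruence $a\equiv b\pmod{p^2}$ between rational numbers whose denominators are prime to $p$ means $a-b\in p^2\mathbb{Z}_{(p)}$. *)

theory Defs
  imports "HOL-Number_Theory.Number_Theory"
begin

fun S :: "nat \<Rightarrow> int" where
  "S 0 = 0"
| "S (Suc 0) = 1"
| "S (Suc (Suc n)) = 4 * S (Suc n) - S n"

fun T :: "nat \<Rightarrow> int" where
  "T 0 = 2"
| "T (Suc 0) = 4"
| "T (Suc (Suc n)) = 4 * T (Suc n) - T n"

text \<open>The Jacobi symbol; meaningful for odd positive \<open>n\<close> only.\<close>

definition Jacobi :: "int \<Rightarrow> nat \<Rightarrow> int" where
  "Jacobi a n = (\<Prod>q\<in>#prime_factorization n. Legendre a (int q))"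

lemma Jacobi_prime: "prime q \<Longrightarrow> Jacobi a q = Legendre a (int q)"
  by (simp add: Jacobi_def prime_factorization_prime)

text \<open>
  The localization of the integers at the prime \<open>p\<close>, as a subring of the rationals.
  As \<open>p dvd 0\<close>, the side condition excludes zero denominators.
\<close>

definition localized_ints :: "nat \<Rightarrow> rat set" where
  "localized_ints p = {of_int a / of_int b | a b. \<not> int p dvd b}"

text \<open>\<open>x \<equiv> y (mod p ^ r)\<close> for rationals, i.e. \<open>x - y \<in> p ^ r * localized_ints p\<close>.\<close>

definition rat_cong :: "nat \<Rightarrow> nat \<Rightarrow> rat \<Rightarrow> rat \<Rightarrow> bool" where
  "rat_cong p r x y \<longleftrightarrow> x - y \<in> (\<lambda>z. of_nat (p ^ r) * z) ` localized_ints p"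

lemma rat_cong_of_int_iff:
  assumes "prime p"
  shows "rat_cong p r (of_int x) (of_int y) \<longleftrightarrow> [x = y] (mod int (p ^ r))"
proof
  assume "rat_cong p r (of_int x) (of_int y)"
  then obtain a b where b: "\<not> int p dvd b"
    and eq: "(of_int x - of_int y :: rat) = of_nat (p ^ r) * (of_int a / of_int b)"
    unfolding rat_cong_def localized_ints_def by blast
  from b have "b \<noteq> 0" by auto
  with eq have "(of_int ((x - y) * b) :: rat) = of_int (int (p ^ r) * a)"
    by (simp add: field_simps)
  then have "(x - y) * b = int (p ^ r) * a"
    by (simp only: of_int_eq_iff)
  then have "int (p ^ r) dvd (x - y) * b" by simp
  moreover have "coprime (int (p ^ r)) b"
    using assms b by (simp add: prime_imp_coprime)
  ultimately show "[x = y] (mod int (p ^ r))"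
    by (simp add: coprime_dvd_mult_left_iff cong_iff_dvd_diff)
next
  assume "[x = y] (mod int (p ^ r))"
  then obtain a where "x - y = int (p ^ r) * a"
    by (auto simp: cong_iff_dvd_diff)
  then have "(of_int x - of_int y :: rat) = of_nat (p ^ r) * (of_int a / of_int 1)"
    by (metis div_by_1 of_int_1 of_int_diff of_int_mult of_int_of_nat_eq)
  moreover have "\<not> int p dvd 1"
    using assms not_prime_unit by (metis prime_nat_int_transfer)
  ultimately show "rat_cong p r (of_int x) (of_int y)"
    unfolding rat_cong_def localized_ints_def by blast
qed

end

theory Submission
  imports Defs
begin

text \<open>
  Work in \<open>Z[sqrt 3]\<close> with the unit \<open>u = 2 + sqrt 3\<close>, whose powers are \<open>u ^ k = T k / 2 + S k * sqrt 3\<close>,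
  and its inverse \<open>m = 2 - sqrt 3\<close>. The sum of \<open>(2k choose k) * m ^ (p - 1 - k)\<close> over \<open>k < p\<close> is a
  convolution of the binomials \<open>2p choose k\<close> with the Lucas sequence of parameters \<open>(m - 2, 1)\<close>.
  As \<open>2p choose k \<equiv> 2 * (p choose k)\<close> modulo \<open>p\<^sup>2\<close> for \<open>0 < k < p\<close>, the sum is congruent to
  \<open>2 * lucas_U m m p - lucas_U (m - 2) 1 p\<close>.
  For \<open>n = (p - 1) / 2\<close>, \<open>(2k choose k) / (-16) ^ k \<equiv> n + k choose 2k\<close> modulo \<open>p\<^sup>2\<close>, which turns the
  half-range sums into a Chebyshev-type polynomial in \<open>- u\<close>, again a combination of Lucas numbers of
  parameters \<open>(2 - u, 1)\<close>. Since \<open>m - 2 = 2 - u = - sqrt 3\<close> is a sum of two primitive twelfth roots of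
  unity with product 1, these Lucas numbers have period 12, and everything depends only on \<open>p mod 24\<close>.
\<close>

section \<open>Lucas sequences and their convolutions with binomial coefficients\<close>

fun lucas_U :: "'a::comm_ring_1 \<Rightarrow> 'a \<Rightarrow> nat \<Rightarrow> 'a" where
  "lucas_U P Q 0 = 0"
| "lucas_U P Q (Suc 0) = 1"
| "lucas_U P Q (Suc (Suc n)) = P * lucas_U P Q (Suc n) - Q * lucas_U P Q n"

text \<open>The coefficient of \<open>x ^ M\<close> in \<open>(1 + x) ^ N\<close> times the
  generating function of \<open>u\<close>.\<close>

definition binomial_conv :: "(nat \<Rightarrow> 'a::comm_ring_1) \<Rightarrow> nat \<Rightarrow> nat \<Rightarrow> 'a" where
  "binomial_conv u N M = (\<Sum>k\<le>M. of_nat (N choose k) * u (M - k))"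

lemma binomial_conv_Suc_Suc:
  "binomial_conv u (Suc N) (Suc M) = binomial_conv u N (Suc M) + binomial_conv u N M"
proof -
  have "binomial_conv u (Suc N) (Suc M) =
      u (Suc M) + (\<Sum>k\<le>M. of_nat (Suc N choose Suc k) * u (M - k))"
    by (simp only: binomial_conv_def sum.atMost_Suc_shift) simp
  also have "(\<Sum>k\<le>M. of_nat (Suc N choose Suc k) * u (M - k)) =
      binomial_conv u N M + (\<Sum>k\<le>M. of_nat (N choose Suc k) * u (M - k))"
    by (simp add: binomial_conv_def sum.distrib algebra_simps)
  also have "u (Suc M) + (binomial_conv u N M + (\<Sum>k\<le>M. of_nat (N choose Suc k) * u (M - k))) =
      binomial_conv u N (Suc M) + binomial_conv u N M"
    by (simp only: binomial_conv_def sum.atMost_Suc_shift) simp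
  finally show ?thesis .
qed

text \<open>The Lucas recurrence applies to each summand with \<open>k \<le> M\<close>. The summand
  \<open>k = Suc M\<close> carries the initial value 1 and leaves the inhomogeneous binomial; the
  last summand vanishes with the initial value 0.\<close>

lemma binomial_conv_lucas_rec:
  "binomial_conv (lucas_U P Q) N (Suc (Suc M)) =
     P * binomial_conv (lucas_U P Q) N (Suc M) - Q * binomial_conv (lucas_U P Q) N M
     + of_nat (N choose Suc M)"
proof -
  have *: "lucas_U P Q (Suc (Suc M) - k) = P * lucas_U P Q (Suc M - k) - Q * lucas_U P Q (M - k)"
    if "k \<le> M" for k
    using that by (simp add: Suc_diff_le)
  have "(\<Sum>k\<le>M. of_nat (N choose k) * lucas_U P Q (Suc (Suc M) - k)) =
     (\<Sum>k\<le>M. of_nat (N choose k) *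
        (P * lucas_U P Q (Suc M - k) - Q * lucas_U P Q (M - k)))"
    by (intro sum.cong refl) (simp only: * atMost_iff)
  also have "\<dots> = P * (\<Sum>k\<le>M. of_nat (N choose k) * lucas_U P Q (Suc M - k))
     - Q * (\<Sum>k\<le>M. of_nat (N choose k) * lucas_U P Q (M - k))"
    by (simp add: sum_distrib_left sum_subtractf algebra_simps)
  finally show ?thesis
    unfolding binomial_conv_def by (simp add: sum.atMost_Suc Suc_diff_le)
qed

text \<open>Both sides turn from \<open>n\<close> to \<open>Suc n\<close> by multiplying with
  \<open>m\<close> and adding the central binomial of \<open>2 * n\<close>. On the right, two Pascal
  steps contribute \<open>2 * ?A (2 * n) n\<close>, which cancels the 2 in the parameter
  \<open>m - 2\<close>, and the values at \<open>n - 1\<close> cancel because the second parameter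
  is 1.\<close>

lemma sum_central_binomial_eq_conv:
  fixes m :: "'a::comm_ring_1"
  shows "(\<Sum>k<n. of_nat ((2 * k) choose k) * m ^ (n - 1 - k)) =
         binomial_conv (lucas_U (m - 2) 1) (2 * n) n"
proof (induction n)
  case 0
  then show ?case by (simp add: binomial_conv_def)
next
  case (Suc n)
  let ?A = "binomial_conv (lucas_U (m - 2) 1)"
  have "(\<Sum>k<Suc n. of_nat ((2 * k) choose k) * m ^ (Suc n - 1 - k)) =
      m * (\<Sum>k<n. of_nat ((2 * k) choose k) * m ^ (n - 1 - k)) + of_nat ((2 * n) choose n)"
  proof -
    have "of_nat ((2 * k) choose k) * m ^ (n - k) =
        m * (of_nat ((2 * k) choose k) * m ^ (n - 1 - k))" if "k < n" for k
    proof -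
      from that have "n - k = Suc (n - 1 - k)" by simp
      then show ?thesis by simp
    qed
    then have "(\<Sum>k<n. of_nat ((2 * k) choose k) * m ^ (n - k)) =
      (\<Sum>k<n. m * (of_nat ((2 * k) choose k) * m ^ (n - 1 - k)))"
      by (intro sum.cong) simp_all
    then show ?thesis by (simp add: sum_distrib_left)
  qed
  also have "\<dots> = m * ?A (2 * n) n + of_nat ((2 * n) choose n)"
    by (simp only: Suc.IH)
  also have "\<dots> = ?A (2 * Suc n) (Suc n)"
  proof (cases n)
    case 0
    then show ?thesis by (simp add: binomial_conv_def)
  next
    case (Suc l)
    have "?A (2 * Suc n) (Suc n) = ?A (2 * n) (Suc n) + 2 * ?A (2 * n) n + ?A (2 * n) l"
      by (simp add: Suc binomial_conv_Suc_Suc algebra_simps)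
    also have "?A (2 * n) (Suc n) =
        (m - 2) * ?A (2 * n) n - ?A (2 * n) l + of_nat ((2 * n) choose n)"
      unfolding Suc by (simp only: binomial_conv_lucas_rec mult_1)
    finally show ?thesis by (simp add: algebra_simps)
  qed
  finally show ?case .
qed

text \<open>If z and 1/z are the roots for the parameters \<open>(m - 2, 1)\<close>, the binomial
  theorem replaces them by 1 + z and 1 + 1/z, whose sum and product are both \<open>m\<close>. The
  induction avoids roots by following two neighbouring values.\<close>

lemma binomial_conv_diag_eq_lucas:
  fixes m :: "'a::comm_ring_1"
  shows "binomial_conv (lucas_U (m - 2) 1) n n = lucas_U m m n"
proof -
  let ?A = "binomial_conv (lucas_U (m - 2) 1)"
  have "?A n n = lucas_U m m n \<and> ?A n (Suc n) = lucas_U m m (Suc n) - lucas_U m m n"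
  proof (induction n)
    case 0
    then show ?case by (simp add: binomial_conv_def binomial_eq_0)
  next
    case (Suc n)
    \<comment> \<open>Beyond the diagonal the inhomogeneous term \<open>n choose Suc n\<close> is
      zero, so the pair of values determines the next pair.\<close>
    have rec: "?A n (Suc (Suc n)) = (m - 2) * ?A n (Suc n) - ?A n n"
      by (simp add: binomial_conv_lucas_rec binomial_eq_0)
    have "?A (Suc n) (Suc n) = lucas_U m m (Suc n)"
      using Suc.IH by (simp add: binomial_conv_Suc_Suc)
    moreover have "?A (Suc n) (Suc (Suc n)) = (m - 1) * ?A n (Suc n) - ?A n n"
      by (simp only: binomial_conv_Suc_Suc[of _ n "Suc n"] rec) (simp add: algebra_simps)
    ultimately show ?case using Suc.IH by (simp add: algebra_simps)
  qed
  then show ?thesis ..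
qed

text \<open>With z + 1/z = m - 2 one has (1 + z)^2 = m z, so even powers of 1 + z reduce to powers
  of z up to the factor \<open>m ^ j\<close>.\<close>

lemma lucas_U_diag:
  fixes m :: "'a::comm_ring_1"
  shows "lucas_U m m (2 * j) = m ^ j * lucas_U (m - 2) 1 j"
    and "lucas_U m m (Suc (2 * j)) = m ^ j * (lucas_U (m - 2) 1 (Suc j) + lucas_U (m - 2) 1 j)"
proof (induction j)
  case (Suc j)
  {
    case 1
    show ?case using Suc by (simp add: algebra_simps)
  next
    case 2
    show ?case using Suc by (simp add: algebra_simps)
  }
qed simp_all

section \<open>Full-range sums modulo the square of p\<close>

text \<open>In Vandermonde's identity the two outer terms give \<open>2 * (p choose k)\<close>, and
  every inner term is a product of two binomials divisible by \<open>p\<close>.\<close>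

lemma prime_square_dvd_choose_double:
  assumes "prime p" "0 < k" "k < p"
  shows "(int p)\<^sup>2 dvd int ((2 * p) choose k) - 2 * int (p choose k)"
proof -
  have "int ((2 * p) choose k) = (\<Sum>i\<le>k. int (p choose i) * int (p choose (k - i)))"
    using arg_cong[OF vandermonde[of p p k], of int] by (simp add: mult_2)
  also have "{..k} = insert 0 (insert k {0<..<k})"
    using assms by auto
  also have "(\<Sum>i\<in>\<dots>. int (p choose i) * int (p choose (k - i))) =
      2 * int (p choose k) + (\<Sum>i\<in>{0<..<k}. int (p choose i) * int (p choose (k - i)))"
    using assms by simp
  finally have *: "int ((2 * p) choose k) - 2 * int (p choose k) =
      (\<Sum>i\<in>{0<..<k}. int (p choose i) * int (p choose (k - i)))"
    by simp
  have "(int p)\<^sup>2 dvd int (p choose i) * int (p choose (k - i))" if "i \<in> {0<..<k}" for i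
  proof -
    have "p dvd p choose i" "p dvd p choose (k - i)"
      using that assms by (auto intro!: dvd_choose_prime)
    then show ?thesis by (simp add: power2_eq_square mult_dvd_mono)
  qed
  then show ?thesis unfolding * by (rule dvd_sum)
qed

lemma of_int_dvd_of_int:
  "a dvd b \<Longrightarrow> (of_int a :: 'a::comm_ring_1) dvd of_int b"
  by (metis dvd_def of_int_mult)

text \<open>The correction \<open>- u p\<close> belongs to \<open>k = 0\<close>, where the binomial
  is 1 on both sides and must not be doubled; the term \<open>k = p\<close> is killed by
  \<open>u 0 = 0\<close>.\<close>

lemma prime_square_dvd_conv:
  fixes u :: "nat \<Rightarrow> 'a::comm_ring_1"
  assumes "prime p" "u 0 = 0"
  shows "of_int ((int p)\<^sup>2) dvd
    binomial_conv u (2 * p) p - (2 * binomial_conv u p p - u p)"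
proof -
  have p: "{..p} = insert 0 (insert p {0<..<p})" "0 < p"
    using prime_gt_0_nat[OF assms(1)] by auto
  have "binomial_conv u (2 * p) p - (2 * binomial_conv u p p - u p) =
    (\<Sum>k\<in>{0<..<p}. of_int (int ((2 * p) choose k) - 2 * int (p choose k)) * u (p - k))"
    using p(2) assms(2)
    by (simp add: binomial_conv_def p(1) algebra_simps sum_subtractf sum_distrib_left)
  moreover have "of_int ((int p)\<^sup>2) dvd
      (of_int (int ((2 * p) choose k) - 2 * int (p choose k)) * u (p - k))"
    if "k \<in> {0<..<p}" for k
    using that prime_square_dvd_choose_double[OF assms(1)]
    by (intro dvd_mult2 of_int_dvd_of_int) auto
  ultimately show ?thesis
    by (simp only: dvd_sum)
qed

lemma prime_dvd_conv_diag:
  fixes u :: "nat \<Rightarrow> 'a::comm_ring_1"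
  assumes "prime p" "u 0 = 0"
  shows "of_int (int p) dvd binomial_conv u p p - u p"
proof -
  have p: "{..p} = insert 0 (insert p {0<..<p})" "0 < p"
    using prime_gt_0_nat[OF assms(1)] by auto
  have "binomial_conv u p p - u p = (\<Sum>k\<in>{0<..<p}. of_int (int (p choose k)) * u (p - k))"
    using p(2) assms(2) by (simp add: binomial_conv_def p(1))
  moreover have "of_int (int p) dvd (of_int (int (p choose k)) * u (p - k))"
    if "k \<in> {0<..<p}" for k
    using that assms(1)
    by (intro dvd_mult2 of_int_dvd_of_int) (auto intro!: dvd_choose_prime)
  ultimately show ?thesis
    by (simp only: dvd_sum)
qed

text \<open>Since \<open>s \<equiv> e * a ^ j\<close> modulo \<open>p\<close>, the value
  \<open>2 * a ^ j * s - a ^ (2 * j) * e = e * (s\<^sup>2 - (s - e * a ^ j)\<^sup>2)\<close> is known modulo \<open>p\<^sup>2\<close>.\<close>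

lemma sum_central_binomial_cong:
  fixes a m :: "'a::comm_ring_1"
  defines "w \<equiv> lucas_U (m - 2) 1"
  assumes "prime p" "p = 2 * j + 1" "a * m = 1" "w p = e" "e * e = 1"
  shows "of_int ((int p)\<^sup>2) dvd
    (\<Sum>k<p. of_nat ((2 * k) choose k) * a ^ k) - e * (w (Suc j) + w j)\<^sup>2"
proof -
  define s where "s = w (Suc j) + w j"
  have w0: "w 0 = 0" by (simp add: w_def)
  have am: "a ^ k * m ^ k = 1" for k
    using assms(4) by (metis power_mult_distrib power_one)
  have diag: "binomial_conv w p p = m ^ j * s"
    unfolding w_def s_def using binomial_conv_diag_eq_lucas[of m p] lucas_U_diag(2)[of m j] assms(3)
    by simp
  have "of_int (int p) dvd m ^ j * s - e"
    using prime_dvd_conv_diag[of p w] assms w0 diag by simp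
  then have "of_int (int p) dvd a ^ j * (m ^ j * s - e)" by (rule dvd_mult)
  also have "a ^ j * (m ^ j * s - e) = s - e * a ^ j"
    using am[of j] by (simp add: algebra_simps mult.assoc[symmetric])
  finally have "of_int ((int p)\<^sup>2) dvd (s - e * a ^ j)\<^sup>2"
    by (simp add: power2_eq_square mult_dvd_mono)
  then have 1: "of_int ((int p)\<^sup>2) dvd e * (s - e * a ^ j)\<^sup>2" by (rule dvd_mult)
  have square: "a ^ (2 * j) = a ^ j * a ^ j"
    by (simp add: mult_2 power_add)
  \<comment> \<open>As \<open>p - 1 = 2 * j\<close> and \<open>a\<close> is inverse to
    \<open>m\<close>, the factor \<open>a ^ (2 * j)\<close> reverses the powers:
    \<open>m ^ (p - 1 - k)\<close> becomes \<open>a ^ k\<close>.\<close>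
  have summand: "a ^ (2 * j) * (of_nat ((2 * k) choose k) * m ^ (p - 1 - k)) =
      of_nat ((2 * k) choose k) * a ^ k" if "k < p" for k
  proof -
    have "a ^ (2 * j) = a ^ k * a ^ (p - 1 - k)"
      using that assms(3) by (simp flip: power_add)
    then have "a ^ (2 * j) * (of_nat ((2 * k) choose k) * m ^ (p - 1 - k)) =
        of_nat ((2 * k) choose k) * a ^ k * (a ^ (p - 1 - k) * m ^ (p - 1 - k))"
      by (simp only: mult_ac)
    then show ?thesis by (simp only: am mult_1_right)
  qed
  have sum: "a ^ (2 * j) * (\<Sum>k<p. of_nat ((2 * k) choose k) * m ^ (p - 1 - k)) =
      (\<Sum>k<p. of_nat ((2 * k) choose k) * a ^ k)"
    unfolding sum_distrib_left by (intro sum.cong refl) (use summand in simp)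
  have "of_int ((int p)\<^sup>2) dvd a ^ (2 * j) * (binomial_conv w (2 * p) p - (2 * (m ^ j * s) - e))"
    using prime_square_dvd_conv[of p w] assms(2,5) w0 diag by (intro dvd_mult) simp
  also have "a ^ (2 * j) * (binomial_conv w (2 * p) p - (2 * (m ^ j * s) - e)) =
      (\<Sum>k<p. of_nat ((2 * k) choose k) * a ^ k) - (2 * a ^ j * s - a ^ (2 * j) * e)"
  proof -
    have "a ^ (2 * j) * (2 * (m ^ j * s)) = 2 * a ^ j * s * (a ^ j * m ^ j)"
      unfolding square by (simp only: mult_ac)
    then show ?thesis
      using sum[unfolded sum_central_binomial_eq_conv, folded w_def]
      by (simp only: right_diff_distrib am mult_1_right)
  qed
  finally have 2: "of_int ((int p)\<^sup>2) dvd
      (\<Sum>k<p. of_nat ((2 * k) choose k) * a ^ k) - (2 * a ^ j * s - a ^ (2 * j) * e)" .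
  have complete_square: "e * (s - e * b)\<^sup>2 = e * s\<^sup>2 - (2 * b * s - b * b * e)" for b
  proof -
    have "e * (s - e * b)\<^sup>2 = e * s\<^sup>2 - (e * e) * (2 * b * s - b * b * e)"
      by (simp add: power2_eq_square algebra_simps)
    then show ?thesis by (simp only: assms(6) mult_1)
  qed
  have "(\<Sum>k<p. of_nat ((2 * k) choose k) * a ^ k) - e * s\<^sup>2 =
      ((\<Sum>k<p. of_nat ((2 * k) choose k) * a ^ k) - (2 * a ^ j * s - a ^ (2 * j) * e))
      - e * (s - e * a ^ j)\<^sup>2"
    by (simp only: complete_square square) (simp add: algebra_simps)
  then show ?thesis using dvd_diff[OF 2 1] by (simp only: s_def)
qed

section \<open>Binomials for the half-range sums\<close>

text \<open>Pascal's rule couples these sums \<open>F\<close> with the sums \<open>G\<close> over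
  odd lower entries; eliminating \<open>G\<close> leaves the Lucas recurrence for
  \<open>F\<close>.\<close>

lemma sum_choose_add_double_eq_lucas:
  fixes y :: "'a::comm_ring_1"
  shows "(\<Sum>k\<le>n. of_nat ((n + k) choose (2 * k)) * y ^ k) =
    lucas_U (2 + y) 1 (Suc n) - lucas_U (2 + y) 1 n"
proof -
  define F where "F n = (\<Sum>k\<le>n. of_nat ((n + k) choose (2 * k)) * y ^ k)" for n
  define G where "G n = (\<Sum>k<n. of_nat ((n + k) choose (2 * k + 1)) * y ^ k)" for n
  have F: "F (Suc n) = F n + y * G (Suc n)" for n
  proof -
    have "F (Suc n) = 1 + (\<Sum>k\<le>n. of_nat ((n + Suc k) choose (2 * Suc k)) * y ^ Suc k)
        + (\<Sum>k\<le>n. of_nat ((Suc n + k) choose (2 * k + 1)) * y ^ Suc k)"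
    proof -
      have "of_nat ((Suc n + Suc k) choose (2 * Suc k)) * y ^ Suc k =
          of_nat ((n + Suc k) choose (2 * Suc k)) * y ^ Suc k
          + of_nat ((Suc n + k) choose (2 * k + 1)) * y ^ Suc k" for k
        using binomial_Suc_Suc[of "n + Suc k" "2 * k + 1"]
        by (simp add: distrib_right add.commute del: binomial_Suc_Suc power_Suc)
      then show ?thesis
        unfolding F_def by (simp only: sum.atMost_Suc_shift sum.distrib) simp
    qed
    also have "1 + (\<Sum>k\<le>n. of_nat ((n + Suc k) choose (2 * Suc k)) * y ^ Suc k) =
        (\<Sum>k\<le>Suc n. of_nat ((n + k) choose (2 * k)) * y ^ k)"
      by (simp only: sum.atMost_Suc_shift) simp
    also have "\<dots> = F n" by (simp add: F_def binomial_eq_0)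
    finally show ?thesis
      by (simp add: G_def sum_distrib_left lessThan_Suc_atMost mult_ac)
  qed
  have G: "G (Suc n) = G n + F n" for n
  proof -
    have "G (Suc n) = (\<Sum>k\<le>n. of_nat ((n + k) choose (2 * k + 1)) * y ^ k) + F n"
      unfolding F_def G_def lessThan_Suc_atMost by (simp add: sum.distrib algebra_simps)
    also have "(\<Sum>k\<le>n. of_nat ((n + k) choose (2 * k + 1)) * y ^ k) = G n"
      by (simp add: G_def binomial_eq_0 flip: lessThan_Suc_atMost)
    finally show ?thesis .
  qed
  have rec: "F (Suc (Suc n)) = (2 + y) * F (Suc n) - F n" for n
    using F[of "Suc n"] F[of n] G[of "Suc n"] by (simp add: algebra_simps)
  have "F n = lucas_U (2 + y) 1 (Suc n) - lucas_U (2 + y) 1 n"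
  proof (induction n rule: induct_nat_012)
    case (ge2 n)
    then show ?case
      by (simp only: rec ge2 lucas_U.simps(3) mult_1) (simp add: algebra_simps)
  qed (simp_all add: F_def algebra_simps)
  then show ?thesis by (simp add: F_def)
qed

text \<open>The quotient (n + k)! / (n - k)! is the product of (n + j + 1)(n - j) over j < k, and
  four times each factor is a difference of odd squares. For \<open>p = 2 * n + 1\<close> the first
  square is that of \<open>p\<close>.\<close>

lemma choose_add_double_prod:
  assumes "k \<le> n"
  shows "4 ^ k * int (fact (2 * k)) * int ((n + k) choose (2 * k)) =
    (\<Prod>j<k. (2 * int n + 1)\<^sup>2 - (2 * int j + 1)\<^sup>2)"
  using assms
proof (induction k)
  case (Suc k)
  have "4 ^ k * int (fact (2 * k)) * int ((n + k) choose (2 * k)) * (4 * (int n + int k + 1) * (int n - int k))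
    = 4 ^ Suc k * int (fact (2 * Suc k)) * int ((n + Suc k) choose (2 * Suc k))"
  proof -
    have "fact (n + k) = fact (2 * k) * fact (n - k) * ((n + k) choose (2 * k))"
      using binomial_fact_lemma[of "2 * k" "n + k"] Suc.prems by simp
    moreover have "fact (n + Suc k) = fact (2 * Suc k) * fact (n - Suc k) * ((n + Suc k) choose (2 * Suc k))"
      using binomial_fact_lemma[of "2 * Suc k" "n + Suc k"] Suc.prems by simp
    moreover have "fact (n - k) = (n - k) * fact (n - Suc k)"
      using Suc.prems fact_reduce[where 'a = nat, of "n - k"] by simp
    moreover have "fact (n + Suc k) = (n + k + 1) * fact (n + k)" by simp
    ultimately have "fact (n - Suc k) * ((n + k + 1) * (n - k) * fact (2 * k) * ((n + k) choose (2 * k))) =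
      fact (n - Suc k) * (fact (2 * Suc k) * ((n + Suc k) choose (2 * Suc k)))"
      by (simp only: mult_ac)
    then have "(n + k + 1) * (n - k) * fact (2 * k) * ((n + k) choose (2 * k)) =
      fact (2 * Suc k) * ((n + Suc k) choose (2 * Suc k))"
      by (simp only: mult_cancel1 fact_nonzero) simp
    then have "int ((n + k + 1) * (n - k) * fact (2 * k) * ((n + k) choose (2 * k))) =
      int (fact (2 * Suc k) * ((n + Suc k) choose (2 * Suc k)))"
      by (rule arg_cong)
    moreover have "int (n - k) = int n - int k" using Suc.prems by simp
    ultimately have "(int n + int k + 1) * (int n - int k) * int (fact (2 * k)) * int ((n + k) choose (2 * k)) =
      int (fact (2 * Suc k)) * int ((n + Suc k) choose (2 * Suc k))"
      by (simp only: of_nat_mult of_nat_add of_nat_1)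
    then show ?thesis by (simp only: power_Suc mult_ac)
  qed
  then have "4 ^ Suc k * int (fact (2 * Suc k)) * int ((n + Suc k) choose (2 * Suc k)) =
    (\<Prod>j<k. (2 * int n + 1)\<^sup>2 - (2 * int j + 1)\<^sup>2) * (4 * (int n + int k + 1) * (int n - int k))"
    using Suc by (simp only: Suc_leD)
  moreover have "(2 * int n + 1)\<^sup>2 - (2 * int k + 1)\<^sup>2 = 4 * (int n + int k + 1) * (int n - int k)"
    by (simp add: power2_eq_square algebra_simps)
  ultimately show ?case by (simp only: prod.lessThan_Suc)
qed simp

text \<open>The left side is the square of (2k)! / k!, which is 2^k times the product of the first k
  odd numbers.\<close>

lemma central_binomial_prod:
  "int (fact (2 * k)) * int ((2 * k) choose k) = 4 ^ k * (\<Prod>j<k. (2 * int j + 1)\<^sup>2)"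
proof (induction k)
  case (Suc k)
  have square: "((2 * k + 2) * (2 * k + 1) * F) * ((2 * k + 2) * (2 * k + 1) * F) =
      ((k + 1) * f) * ((k + 1) * f) * (F * c * (4 * (2 * k + 1)\<^sup>2))"
    if "F = f * f * c" for F f c :: nat
    by (simp add: that power2_eq_square algebra_simps)
  have fact_double: "fact (2 * l) = fact l * fact l * ((2 * l) choose l)" for l :: nat
    using binomial_fact_lemma[of l "2 * l"] by simp
  \<comment> \<open>Multiplying by the square of \<open>fact (Suc k)\<close> keeps the step free of
    division; the factor is cancelled at the end.\<close>
  have "(fact (Suc k) * fact (Suc k)) * (fact (2 * Suc k) * ((2 * Suc k) choose Suc k)) =
      fact (2 * Suc k) * (fact (2 * Suc k) :: nat)"
  proof -
    have "f * f * (F * c) = F * F" if "F = f * f * c" for F f c :: nat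
      by (simp add: that mult_ac)
    from this[OF fact_double[of "Suc k"]] show ?thesis .
  qed
  also have "\<dots> = ((2 * k + 2) * (2 * k + 1) * fact (2 * k)) * ((2 * k + 2) * (2 * k + 1) * fact (2 * k))"
  proof -
    have "fact (2 * Suc k) = (2 * k + 2) * (2 * k + 1) * (fact (2 * k) :: nat)"
      by (simp add: algebra_simps)
    then show ?thesis by (simp only:)
  qed
  also have "\<dots> = fact (Suc k) * fact (Suc k) * (fact (2 * k) * ((2 * k) choose k) * (4 * (2 * k + 1)\<^sup>2))"
  proof -
    have "fact (Suc k) = (k + 1) * (fact k :: nat)"
      by simp
    then show ?thesis using square[OF fact_double[of k]] by (simp only:)
  qed
  finally have "fact (2 * Suc k) * ((2 * Suc k) choose Suc k) =
      fact (2 * k) * ((2 * k) choose k) * (4 * (2 * k + 1)\<^sup>2)"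
    by (simp only: mult_cancel1 mult_eq_0_iff fact_nonzero simp_thms)
  from arg_cong[OF this, of int] show ?case
    using Suc by (simp only: of_nat_mult) (simp add: algebra_simps)
qed simp

text \<open>The two preceding products agree factor by factor modulo the square of \<open>p\<close>,
  up to sign; signs and powers of 4 collect to \<open>(-16) ^ k\<close>. The common factor
  \<open>fact (2 * k)\<close> cancels because \<open>2 * k < p\<close>.\<close>

lemma central_binomial_cong_choose:
  assumes "prime p" "p = 2 * n + 1" "k \<le> n"
  shows "(int p)\<^sup>2 dvd int ((2 * k) choose k) - (-16) ^ k * int ((n + k) choose (2 * k))"
proof -
  have "[(\<Prod>j<k. - ((2 * int n + 1)\<^sup>2 - (2 * int j + 1)\<^sup>2)) = (\<Prod>j<k. (2 * int j + 1)\<^sup>2)] (mod (int p)\<^sup>2)"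
    by (intro cong_prod) (simp add: assms(2) cong_iff_dvd_diff add.commute)
  then have "(int p)\<^sup>2 dvd 4 ^ k * (\<Prod>j<k. (2 * int j + 1)\<^sup>2) -
      4 ^ k * (\<Prod>j<k. - ((2 * int n + 1)\<^sup>2 - (2 * int j + 1)\<^sup>2))"
    unfolding right_diff_distrib[symmetric] by (metis cong_iff_dvd_diff cong_sym dvd_mult)
  also have "(\<Prod>j<k. - ((2 * int n + 1)\<^sup>2 - (2 * int j + 1)\<^sup>2)) =
      (-1) ^ k * (\<Prod>j<k. (2 * int n + 1)\<^sup>2 - (2 * int j + 1)\<^sup>2)"
    by (subst prod_uminus) simp
  also have "4 ^ k * (\<Prod>j<k. (2 * int j + 1)\<^sup>2) -
      4 ^ k * ((-1) ^ k * (\<Prod>j<k. (2 * int n + 1)\<^sup>2 - (2 * int j + 1)\<^sup>2)) =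
    int (fact (2 * k)) * int ((2 * k) choose k) -
      4 ^ k * ((-1) ^ k * (4 ^ k * int (fact (2 * k)) * int ((n + k) choose (2 * k))))"
    by (simp only: central_binomial_prod choose_add_double_prod[OF assms(3)])
  also have "\<dots> = int (fact (2 * k)) *
      (int ((2 * k) choose k) - (-16) ^ k * int ((n + k) choose (2 * k)))"
  proof -
    have "(-16) ^ k = 4 ^ k * ((-1) ^ k * (4 ^ k :: int))"
      by (simp flip: power_mult_distrib)
    then show ?thesis by (simp add: algebra_simps)
  qed
  finally have "(int p)\<^sup>2 dvd int (fact (2 * k)) *
      (int ((2 * k) choose k) - (-16) ^ k * int ((n + k) choose (2 * k)))" .
  moreover have "coprime ((int p)\<^sup>2) (int (fact (2 * k)))"
  proof -
    have "\<not> p dvd fact (2 * k)"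
      using assms by (simp add: prime_dvd_fact_iff)
    then have "coprime p (fact (2 * k))"
      using assms(1) by (simp add: prime_imp_coprime)
    then have "coprime (int p) (int (fact (2 * k)))"
      by (simp only: coprime_int_iff)
    then show ?thesis by simp
  qed
  ultimately show ?thesis by (simp only: coprime_dvd_mult_right_iff)
qed

section \<open>The ring Z[sqrt 3] and the twelve-periodic Lucas sequence\<close>

datatype zsqrt3 = Zsqrt3 (rat_part: int) (irrat_part: int)

instantiation zsqrt3 :: comm_ring_1
begin

definition "0 = Zsqrt3 0 0"
definition "1 = Zsqrt3 1 0"
definition "x + y = Zsqrt3 (rat_part x + rat_part y) (irrat_part x + irrat_part y)"
definition "x - y = Zsqrt3 (rat_part x - rat_part y) (irrat_part x - irrat_part y)"
definition "- x = Zsqrt3 (- rat_part x) (- irrat_part x)"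
definition "x * y = Zsqrt3 (rat_part x * rat_part y + 3 * (irrat_part x * irrat_part y))
  (rat_part x * irrat_part y + irrat_part x * rat_part y)"

instance
  by standard
    (simp_all add: zero_zsqrt3_def one_zsqrt3_def plus_zsqrt3_def minus_zsqrt3_def
      uminus_zsqrt3_def times_zsqrt3_def algebra_simps)

end

lemmas zsqrt3_defs = zero_zsqrt3_def one_zsqrt3_def plus_zsqrt3_def minus_zsqrt3_def
  uminus_zsqrt3_def times_zsqrt3_def

lemma of_nat_zsqrt3: "of_nat n = Zsqrt3 (int n) 0"
  by (induction n) (simp_all add: zsqrt3_defs)

lemma of_int_zsqrt3: "of_int n = Zsqrt3 n 0"
  by (cases n) (simp_all add: of_nat_zsqrt3 zsqrt3_defs)

lemma numeral_zsqrt3: "numeral n = Zsqrt3 (numeral n) 0"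
  by (metis of_int_numeral of_int_zsqrt3)

lemma zsqrt3_parts_sum:
  "rat_part (sum f A) = (\<Sum>k\<in>A. rat_part (f k))"
  "irrat_part (sum f A) = (\<Sum>k\<in>A. irrat_part (f k))"
  by (induction A rule: infinite_finite_induct) (simp_all add: zsqrt3_defs)

text \<open>Splits a congruence in Z[sqrt 3] into two integer congruences.\<close>

lemma of_int_dvd_zsqrt3:
  "of_int n dvd x \<longleftrightarrow> n dvd rat_part x \<and> n dvd irrat_part x"
proof
  assume "of_int n dvd x"
  then show "n dvd rat_part x \<and> n dvd irrat_part x"
    by (auto simp: of_int_zsqrt3 zsqrt3_defs elim!: dvdE)
next
  assume "n dvd rat_part x \<and> n dvd irrat_part x"
  then obtain a b where "rat_part x = n * a" "irrat_part x = n * b"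
    by (auto elim!: dvdE)
  then have "x = of_int n * Zsqrt3 a b"
    by (cases x) (simp add: of_int_zsqrt3 zsqrt3_defs)
  then show "of_int n dvd x" by simp
qed

abbreviation unit_zsqrt3 :: zsqrt3 where
  "unit_zsqrt3 \<equiv> Zsqrt3 2 1"

text \<open>The unit is a root of x^2 = 4x - 1, so both coordinates of its powers obey the
  recurrence of \<open>S\<close> and \<open>T\<close>.\<close>

lemma unit_zsqrt3_power:
  "irrat_part (unit_zsqrt3 ^ k) = S k" "2 * rat_part (unit_zsqrt3 ^ k) = T k"
proof -
  have "irrat_part (unit_zsqrt3 ^ k) = S k \<and> 2 * rat_part (unit_zsqrt3 ^ k) = T k"
    by (induction k rule: induct_nat_012) (auto simp: zsqrt3_defs algebra_simps)
  then show "irrat_part (unit_zsqrt3 ^ k) = S k" "2 * rat_part (unit_zsqrt3 ^ k) = T k"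
    by auto
qed

text \<open>The Lucas parameter is \<open>- sqrt 3\<close>, the sum of two primitive twelfth roots of unity.\<close>

definition lucas_root :: "nat \<Rightarrow> zsqrt3" where
  "lucas_root = lucas_U (Zsqrt3 0 (-1)) 1"

lemma lucas_root_mod: "lucas_root n = lucas_root (n mod 12)"
proof -
  \<comment> \<open>The sixth power of a primitive twelfth root of unity is -1. Six unfoldings of
    the recurrence verify this for two arbitrary consecutive values.\<close>
  have "lucas_root (n + 6) = - lucas_root n" for n
    by (cases "lucas_root n"; cases "lucas_root (Suc n)")
      (simp add: lucas_root_def eval_nat_numeral zsqrt3_defs)
  from this[of "n + 6" for n] this have period: "lucas_root (n + 12) = lucas_root n" for n
    by (simp add: add.assoc)
  have "lucas_root (r + 12 * q) = lucas_root r" for q r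
  proof (induction q)
    case (Suc q)
    then show ?case using period[of "r + 12 * q"] by (simp add: add_ac)
  qed simp
  from this[of "n mod 12" "n div 12"] show ?thesis by simp
qed

lemma lucas_root_values:
  "lucas_root 0 = Zsqrt3 0 0" "lucas_root (Suc 0) = Zsqrt3 1 0"
  "lucas_root 2 = Zsqrt3 0 (-1)" "lucas_root 3 = Zsqrt3 2 0"
  "lucas_root 4 = Zsqrt3 0 (-1)" "lucas_root 5 = Zsqrt3 1 0"
  "lucas_root 6 = Zsqrt3 0 0" "lucas_root 7 = Zsqrt3 (-1) 0"
  "lucas_root 8 = Zsqrt3 0 1" "lucas_root 9 = Zsqrt3 (-2) 0"
  "lucas_root 10 = Zsqrt3 0 1" "lucas_root 11 = Zsqrt3 (-1) 0"
  by (simp_all add: lucas_root_def eval_nat_numeral zsqrt3_defs)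

section \<open>From Z[sqrt 3] back to the sums over S and T\<close>

text \<open>The first sum is the \<open>sqrt 3\<close> coordinate of the sum over powers of the
  unit. One more factor \<open>2 + sqrt 3\<close> shifts the index of \<open>S\<close> and sends the
  coordinates \<open>c\<close>, \<open>d\<close> to the \<open>sqrt 3\<close> coordinate
  \<open>c + 2 * d\<close>.\<close>

lemma sums_S_central_binomial_cong:
  assumes "prime p" "p = 2 * j + 1"
    and "lucas_root p = e" "e * e = 1" "e * (lucas_root (Suc j) + lucas_root j)\<^sup>2 = Zsqrt3 c d"
  shows "[(\<Sum>k<p. S k * int ((2 * k) choose k)) = d] (mod (int p)\<^sup>2)"
    and "[(\<Sum>k<p. S (k + 1) * int ((2 * k) choose k)) = c + 2 * d] (mod (int p)\<^sup>2)"
proof -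
  define x where "x = (\<Sum>k<p. of_nat ((2 * k) choose k) * unit_zsqrt3 ^ k)"
  have dvd: "of_int ((int p)\<^sup>2) dvd x - Zsqrt3 c d"
    using sum_central_binomial_cong[of p j unit_zsqrt3 "Zsqrt3 2 (-1)" e] assms
    unfolding x_def by (simp add: lucas_root_def zsqrt3_defs numeral_zsqrt3)
  have dvd_parts: "(int p)\<^sup>2 dvd irrat_part x - d"
    "(int p)\<^sup>2 dvd irrat_part (unit_zsqrt3 * x) - (c + 2 * d)"
    using dvd dvd_mult[OF dvd, of unit_zsqrt3] unfolding of_int_dvd_zsqrt3
    by (simp_all add: zsqrt3_defs algebra_simps)
  have mult: "irrat_part (of_nat n * y) = irrat_part y * int n" for n y
    by (simp add: of_nat_zsqrt3 times_zsqrt3_def)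
  have parts: "irrat_part x = (\<Sum>k<p. S k * int ((2 * k) choose k))"
    by (simp only: x_def zsqrt3_parts_sum mult unit_zsqrt3_power)
  have "unit_zsqrt3 * x = (\<Sum>k<p. of_nat ((2 * k) choose k) * unit_zsqrt3 ^ (k + 1))"
    by (simp add: x_def sum_distrib_left mult_ac)
  then have parts': "irrat_part (unit_zsqrt3 * x) = (\<Sum>k<p. S (k + 1) * int ((2 * k) choose k))"
    by (simp only: zsqrt3_parts_sum mult unit_zsqrt3_power)
  show "[(\<Sum>k<p. S k * int ((2 * k) choose k)) = d] (mod (int p)\<^sup>2)"
    "[(\<Sum>k<p. S (k + 1) * int ((2 * k) choose k)) = c + 2 * d] (mod (int p)\<^sup>2)"
    using dvd_parts unfolding parts parts' cong_iff_dvd_diff .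
qed

lemma rat_cong_of_int_quotient:
  assumes "\<not> int p dvd b" "int (p ^ r) dvd c - b * y" "x * of_int b = of_int c"
  shows "rat_cong p r x (of_int y)"
proof -
  obtain q where q: "c - b * y = int (p ^ r) * q"
    using assms(2) by blast
  have "b \<noteq> 0" using assms(1) by auto
  have "(x - of_int y) * of_int b = of_int (c - b * y)"
    using assms(3) by (simp add: algebra_simps)
  also have "\<dots> = of_nat (p ^ r) * of_int q"
    by (simp only: q of_int_mult of_int_of_nat_eq)
  finally have "x - of_int y = of_nat (p ^ r) * (of_int q / of_int b)"
    using \<open>b \<noteq> 0\<close> by (simp add: field_simps)
  then show ?thesis
    unfolding rat_cong_def localized_ints_def using assms(1) by blast
qed

text \<open>The factor \<open>16 ^ n\<close>, prime to the odd number \<open>p\<close>, clears all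
  denominators; then \<open>central_binomial_cong_choose\<close> applies termwise, and
  \<open>(-16) ^ k / 16 ^ k\<close> leaves the sign.\<close>

lemma rat_cong_sum_central_binomial:
  assumes "prime p" "p = 2 * n + 1"
  shows "rat_cong p 2 (\<Sum>k\<le>n. of_int (f k) / 16 ^ k * of_nat ((2 * k) choose k))
    (of_int (\<Sum>k\<le>n. (-1) ^ k * f k * int ((n + k) choose (2 * k))))"
proof (rule rat_cong_of_int_quotient)
  have "\<not> p dvd 2"
    using primes_dvd_imp_eq[OF assms(1), of 2] assms(2) by (simp, presburger)
  then have "\<not> int p dvd 2"
    using int_dvd_int_iff[of p 2] by simp
  moreover have "(16 :: int) ^ n = 2 ^ (4 * n)"
    by (simp add: power_mult)
  ultimately show "\<not> int p dvd 16 ^ n"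
    using prime_dvd_power[of "int p" 2 "4 * n"] assms(1) by auto
  let ?c = "\<Sum>k\<le>n. 16 ^ (n - k) * f k * int ((2 * k) choose k)"
  have pow: "(16::'b::comm_ring_1) ^ n = 16 ^ (n - k) * 16 ^ k" if "k \<le> n" for k
    using that by (simp flip: power_add)
  have "?c - 16 ^ n * (\<Sum>k\<le>n. (-1) ^ k * f k * int ((n + k) choose (2 * k))) =
    (\<Sum>k\<le>n. 16 ^ (n - k) * f k *
      (int ((2 * k) choose k) - (-16) ^ k * int ((n + k) choose (2 * k))))"
    unfolding sum_distrib_left sum_subtractf[symmetric]
  proof (intro sum.cong refl)
    fix k assume "k \<in> {..n}"
    then have "16 ^ n = 16 ^ (n - k) * (16 ^ k :: int)" by (intro pow) simp
    moreover have "(-16) ^ k = (-1) ^ k * (16 ^ k :: int)" by (simp flip: power_mult_distrib)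
    ultimately show "16 ^ (n - k) * f k * int ((2 * k) choose k)
        - 16 ^ n * ((-1) ^ k * f k * int ((n + k) choose (2 * k))) =
      16 ^ (n - k) * f k * (int ((2 * k) choose k) - (-16) ^ k * int ((n + k) choose (2 * k)))"
      by (simp add: algebra_simps)
  qed
  then show "int (p ^ 2) dvd
      ?c - 16 ^ n * (\<Sum>k\<le>n. (-1) ^ k * f k * int ((n + k) choose (2 * k)))"
    using central_binomial_cong_choose[OF assms] by (auto intro!: dvd_sum dvd_mult)
  show "(\<Sum>k\<le>n. of_int (f k) / 16 ^ k * of_nat ((2 * k) choose k)) * of_int (16 ^ n) =
      (of_int ?c :: rat)"
    unfolding of_int_sum sum_distrib_right
  proof (intro sum.cong refl)
    fix k assume "k \<in> {..n}"
    then have "(16 :: rat) ^ n = 16 ^ (n - k) * 16 ^ k" by (intro pow) simp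
    then show "of_int (f k) / 16 ^ k * of_nat ((2 * k) choose k) * of_int (16 ^ n) =
      (of_int (16 ^ (n - k) * f k * int ((2 * k) choose k)) :: rat)"
      by simp
  qed
qed

text \<open>The case \<open>y = - unit_zsqrt3\<close> of
  \<open>sum_choose_add_double_eq_lucas\<close>, read off by coordinates; \<open>T\<close> is twice
  the rational part, whence \<open>2 * c\<close>.\<close>

lemma sums_S_T_choose:
  assumes "lucas_root (Suc n) - lucas_root n = Zsqrt3 c d"
  shows "(\<Sum>k\<le>n. (-1) ^ k * S k * int ((n + k) choose (2 * k))) = d"
    and "(\<Sum>k\<le>n. (-1) ^ k * T k * int ((n + k) choose (2 * k))) = 2 * c"
proof -
  let ?\<Sigma> = "\<Sum>k\<le>n. of_nat ((n + k) choose (2 * k)) * (- unit_zsqrt3) ^ k"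
  have \<Sigma>: "?\<Sigma> = Zsqrt3 c d"
    using sum_choose_add_double_eq_lucas[of n "- unit_zsqrt3"] assms
    by (simp add: lucas_root_def zsqrt3_defs numeral_zsqrt3)
  have "of_nat N * (- unit_zsqrt3) ^ k = of_int ((-1) ^ k * int N) * unit_zsqrt3 ^ k" for N k
    by (subst power_minus) simp
  then have parts: "irrat_part (of_nat N * (- unit_zsqrt3) ^ k) = (-1) ^ k * S k * int N"
    "2 * rat_part (of_nat N * (- unit_zsqrt3) ^ k) = (-1) ^ k * T k * int N" for N k
    by (simp_all add: of_int_zsqrt3 times_zsqrt3_def flip: unit_zsqrt3_power)
  show "(\<Sum>k\<le>n. (-1) ^ k * S k * int ((n + k) choose (2 * k))) = d"
    using arg_cong[OF \<Sigma>, of irrat_part] by (simp only: zsqrt3_parts_sum parts zsqrt3.sel)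
  have "(\<Sum>k\<le>n. (-1) ^ k * T k * int ((n + k) choose (2 * k))) = 2 * rat_part ?\<Sigma>"
    by (simp only: zsqrt3_parts_sum sum_distrib_left parts)
  then show "(\<Sum>k\<le>n. (-1) ^ k * T k * int ((n + k) choose (2 * k))) = 2 * c"
    by (simp only: \<Sigma> zsqrt3.sel)
qed

section \<open>Values of Legendre symbols\<close>

text \<open>Two numbers among -1, 0, 1 differ by at most 2, which is less than \<open>p\<close>, so
  congruence forces equality.\<close>

lemma Legendre_eqI:
  assumes "prime p" "p > 2" "[x = Legendre a (int p)] (mod int p)" "x \<in> {-1, 0, 1}"
  shows "Legendre a (int p) = x"
proof -
  have "int p dvd x - Legendre a (int p)"
    using assms(3) by (simp add: cong_iff_dvd_diff)
  moreover have "\<bar>x - Legendre a (int p)\<bar> < int p"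
    using assms(2,4) by (auto simp: Legendre_def)
  ultimately show ?thesis
    using dvd_imp_le_int[of "x - Legendre a (int p)" "int p"] by auto
qed

lemma Legendre_mult:
  assumes "prime p" "p > 2"
  shows "Legendre (a * b) (int p) = Legendre a (int p) * Legendre b (int p)"
proof (rule Legendre_eqI[OF assms])
  have "[Legendre a (int p) * Legendre b (int p) = a ^ ((p - 1) div 2) * b ^ ((p - 1) div 2)] (mod int p)"
    by (intro cong_mult euler_criterion assms)
  also have "a ^ ((p - 1) div 2) * b ^ ((p - 1) div 2) = (a * b) ^ ((p - 1) div 2)"
    by (simp add: power_mult_distrib)
  also have "[(a * b) ^ ((p - 1) div 2) = Legendre (a * b) (int p)] (mod int p)"
    by (rule cong_sym[OF euler_criterion[OF assms]])
  finally show "[Legendre a (int p) * Legendre b (int p) = Legendre (a * b) (int p)] (mod int p)" .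
qed (auto simp: Legendre_def)

lemma Legendre_minus_one:
  assumes "prime p" "p > 2"
  shows "Legendre (-1) (int p) = (-1) ^ ((p - 1) div 2)"
proof (rule Legendre_eqI[OF assms])
  show "[(-1) ^ ((p - 1) div 2) = Legendre (-1) (int p)] (mod int p)"
    by (rule cong_sym[OF euler_criterion[OF assms]])
qed (simp add: minus_one_power_iff)

lemma Legendre_mod_3:
  assumes "\<not> 3 dvd a"
  shows "Legendre a 3 = (if a mod 3 = 1 then 1 else -1)"
proof -
  have "[(if a mod 3 = 1 then 1 else -1) = a] (mod int 3)"
    using assms by (auto simp: cong_def) presburger+
  \<comment> \<open>At the prime 3 the exponent in Euler's criterion is 1.\<close>
  also have "[a = Legendre a (int 3)] (mod int 3)"
    using euler_criterion[of 3 a] by (simp add: cong_sym)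
  finally show ?thesis
    using Legendre_eqI[of 3 "if a mod 3 = 1 then 1 else -1" a] by simp
qed

text \<open>Gauss's lemma counts the doubles of 1, ..., h that exceed h, where
  \<open>h = (p - 1) div 2\<close>. All doubles stay below \<open>p\<close>, so nothing is reduced
  and the count is \<open>h - h div 2\<close>.\<close>

lemma Legendre_2:
  assumes "prime p" "p > 2"
  shows "Legendre 2 (int p) = (-1) ^ ((p - 1) div 2 - (p - 1) div 4)"
proof -
  have "\<not> int p dvd 2"
    using assms(2) by (auto dest: zdvd_imp_le)
  then interpret GAUSS p 2
    using assms by unfold_locales (auto simp: cong_0_iff)
  let ?h = "(int p - 1) div 2"
  have C: "C = (\<lambda>x. x * 2) ` A"
  proof -
    have "(x * 2) mod int p = x * 2" if "x \<in> A" for x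
      using that by (auto simp: A_def)
    then show ?thesis unfolding C_def B_def by (auto simp: image_image intro!: image_cong)
  qed
  have "E = (\<lambda>x. x * 2) ` {?h div 2 <.. ?h}"
    unfolding E_def C A_def using assms(2) by auto
  then have "card E = card {?h div 2 <.. ?h}"
    by (simp add: card_image inj_on_def)
  also have "\<dots> = nat (?h - ?h div 2)" by simp
  also have "\<dots> = (p - 1) div 2 - (p - 1) div 4"
  proof -
    obtain h where "p = 2 * h + 1" using odd_p by (auto elim: oddE)
    moreover from this have "?h = int h" "(p - 1) div 4 = h div 2" by auto
    ultimately show ?thesis by (simp add: nat_diff_distrib flip: zdiv_int)
  qed
  finally show ?thesis using gauss_lemma by simp
qed

section \<open>Evaluation by residue classes modulo 24\<close>

theorem theorem1p3:
  fixes p :: nat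
  assumes "prime p" and "p > 3"
  shows "[(\<Sum>k = 0..p - 1. S k * int ((2 * k) choose k)) =
           2 * (Jacobi (int p) 3 - Jacobi (-1) p)] (mod (int p)\<^sup>2)
         \<and> [(\<Sum>k = 0..p - 1. S (k + 1) * int ((2 * k) choose k)) =
           Jacobi (int p) 3] (mod (int p)\<^sup>2)
         \<and> rat_cong p 2
           (\<Sum>k = 0..(p - 1) div 2. of_int (S k) / 16 ^ k * of_nat ((2 * k) choose k))
           ((of_int (Jacobi 6 p) - of_int (Jacobi 2 p)) / 2)
         \<and> rat_cong p 2
           (\<Sum>k = 0..(p - 1) div 2. of_int (T k) / 16 ^ k * of_nat ((2 * k) choose k))
           (3 * of_int (Jacobi 6 p) - of_int (Jacobi 2 p))"
proof -
  define j where "j = (p - 1) div 2"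
  \<comment> \<open>The modulus 24 fixes both \<open>p\<close> and \<open>j = (p - 1) div 2\<close>
    modulo the period 12.\<close>
  define q where "q = p div 24"
  have "\<not> 2 dvd p" "\<not> 3 dvd p"
    using assms primes_dvd_imp_eq[of 2 p] primes_dvd_imp_eq[of 3 p] by auto
  then have "p mod 24 \<in> {1, 5, 7, 11, 13, 17, 19, 23}"
    by (simp, presburger)
  moreover have "p = 24 * q + p mod 24" by (simp add: q_def)
  ultimately obtain r where r: "r \<in> {1, 5, 7, 11, 13, 17, 19, 23}" and p: "p = 24 * q + r"
    by metis
  have p_j: "p = 2 * j + 1" using \<open>\<not> 2 dvd p\<close> by (auto simp: j_def elim!: oddE)
  have j: "j = 12 * q + r div 2" using p p_j r by auto
  have j4: "(p - 1) div 4 = 6 * q + r div 4" using p r by auto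
  have root: "lucas_root p = lucas_root (r mod 12)"
    "lucas_root j = lucas_root (r div 2 mod 12)" "lucas_root (Suc j) = lucas_root (Suc (r div 2) mod 12)"
  proof -
    have "p = r + 12 * (2 * q)" "j = r div 2 + 12 * q" "Suc j = Suc (r div 2) + 12 * q"
      unfolding j unfolding p by simp_all
    then have mods: "p mod 12 = r mod 12" "j mod 12 = r div 2 mod 12" "Suc j mod 12 = Suc (r div 2) mod 12"
      by (simp_all only: mod_mult_self2)
    show "lucas_root p = lucas_root (r mod 12)"
      "lucas_root j = lucas_root (r div 2 mod 12)" "lucas_root (Suc j) = lucas_root (Suc (r div 2) mod 12)"
      by (subst lucas_root_mod, simp only: mods)+
  qed
  have p2: "p > 2" using assms(2) by simp
  have J3: "Jacobi (int p) 3 = (if r mod 3 = 1 then 1 else -1)"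
  proof -
    have "\<not> 3 dvd int p" using \<open>\<not> 3 dvd p\<close> by presburger
    moreover have "int p mod 3 = 1 \<longleftrightarrow> r mod 3 = 1" unfolding p by presburger
    ultimately show ?thesis by (simp add: Jacobi_prime Legendre_mod_3)
  qed
  have Jm1: "Jacobi (-1) p = (-1) ^ (r div 2)"
    using Legendre_minus_one[OF assms(1) p2, folded j_def]
    by (simp add: Jacobi_prime assms(1) j power_add power_mult)
  have J2: "Jacobi 2 p = (-1) ^ (r div 2 - r div 4)"
  proof -
    \<comment> \<open>The part of the exponent that depends on \<open>q\<close> is even, so only
      \<open>r\<close> affects the sign.\<close>
    have "j - (p - 1) div 4 = 2 * (3 * q) + (r div 2 - r div 4)"
      using j j4 by linarith
    then have "(-1 :: int) ^ (j - (p - 1) div 4) = (-1) ^ (r div 2 - r div 4)"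
      by (simp only: power_add power_mult) simp
    then show ?thesis
      using Legendre_2[OF assms(1) p2, folded j_def] by (simp only: Jacobi_prime[OF assms(1)])
  qed
  have J6: "Jacobi 6 p = Jacobi 2 p * (Jacobi (int p) 3 * (-1) ^ (r div 2))"
  proof -
    have "Legendre (int p) (int 3) * Legendre (int 3) (int p) = (-1) ^ (j * ((3 - 1) div 2))"
      unfolding j_def using assms p2 by (intro Quadratic_Reciprocity) auto
    then have rec: "Legendre (int p) 3 * Legendre 3 (int p) = (-1) ^ (r div 2)"
      by (simp add: j power_add power_mult)
    \<comment> \<open>Being 1 or -1, this symbol is its own inverse, so reciprocity can be solved
      for the symbol of 3 modulo \<open>p\<close>.\<close>
    have "Legendre (int p) 3 * Legendre (int p) 3 = 1"
      using J3 by (auto simp: Jacobi_prime split: if_splits)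
    then have "Legendre 3 (int p) = Legendre (int p) 3 * (Legendre (int p) 3 * Legendre 3 (int p))"
      by (simp flip: mult.assoc)
    then show ?thesis
      using Legendre_mult[OF assms(1) p2, of 2 3] by (simp add: Jacobi_prime assms(1) rec)
  qed
  define e where "e = lucas_root p"
  define d where "d = 2 * (Jacobi (int p) 3 - Jacobi (-1) p)"
  \<comment> \<open>\<open>c'\<close> and \<open>d'\<close> are the coordinates of
    \<open>lucas_root (Suc j) - lucas_root j\<close>. Both divisions are exact, since the symbols
    are 1 or -1.\<close>
  define d' where "d' = (Jacobi 6 p - Jacobi 2 p) div 2"
  define c' where "c' = (3 * Jacobi 6 p - Jacobi 2 p) div 2"
  have "lucas_root p = e" by (simp add: e_def)
  \<comment> \<open>A finite check over the eight residues \<open>r\<close>. The rational part is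
    written so that \<open>c + 2 * d\<close> in \<open>sums_S_central_binomial_cong\<close> becomes
    \<open>Jacobi (int p) 3\<close>.\<close>
  moreover have "e * e = 1"
    "e * (lucas_root (Suc j) + lucas_root j)\<^sup>2 = Zsqrt3 (Jacobi (int p) 3 - 2 * d) d"
    unfolding d_def e_def root J3 Jm1 using r
    by (auto simp: lucas_root_values zsqrt3_defs power2_eq_square)
  ultimately have part1: "[(\<Sum>k<p. S k * int ((2 * k) choose k)) = d] (mod (int p)\<^sup>2)"
    "[(\<Sum>k<p. S (k + 1) * int ((2 * k) choose k)) = Jacobi (int p) 3] (mod (int p)\<^sup>2)"
    using sums_S_central_binomial_cong[OF assms(1) p_j] by fastforce+
  have "lucas_root (Suc j) - lucas_root j = Zsqrt3 c' d'"
    unfolding c'_def d'_def root J6 J2 J3 using r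
    by (auto simp: lucas_root_values zsqrt3_defs)
  note choose_sums = sums_S_T_choose[OF this]
  have "2 * d' = Jacobi 6 p - Jacobi 2 p" "2 * c' = 3 * Jacobi 6 p - Jacobi 2 p"
    unfolding c'_def d'_def J6 J2 J3 using r by auto
  then have part2: "(of_int (Jacobi 6 p) - of_int (Jacobi 2 p)) / 2 = (of_int d' :: rat)"
    "3 * of_int (Jacobi 6 p) - of_int (Jacobi 2 p) = (of_int (2 * c') :: rat)"
    by (simp_all add: field_simps flip: of_int_diff)
  have ranges: "{0..p - 1} = {..<p}" "{0..(p - 1) div 2} = {..j}"
    using p2 by (auto simp: j_def)
  show ?thesis
    unfolding ranges part2
    using part1 rat_cong_sum_central_binomial[OF assms(1) p_j, of S]
      rat_cong_sum_central_binomial[OF assms(1) p_j, of T]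
    by (simp add: choose_sums d_def)
qed

end
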